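(* Let $\mathcal{A}\in T_{m,n}$, where $m$ is even, and suppose the auxiliary matrix $\bar{A}$ of $\mathcal{A}$ is of the form $\bar{A}=\begin{pmatrix} M(\mathcal{A}) & O\\ O & O\end{pmatrix}$. Then the following are equivalent: (a) $\bar{A}$ is a column competent matrix; (b) for all vectors $\bar{q}$ (that is, for all $q\in\mathbb{R}^n$ with $\bar{q}=\begin{pmatrix} q\\ 0\end{pmatrix}\in\mathbb{R}^N$), the LCP$(\bar{q},\bar{A})$ has a finite number (possibly zero) of $w$-solutions; (c) for all vectors $q\in\mathbb{R}^n$, the TCP$(q,\mathcal{A})$ has a finite number (possibly zero) of $\omega$-solutions.
   Context: $T_{m,n}$ is the set of real tensors $\mathcal{A}=(a_{i_1 i_2\ldots i_m})$ of order $m$ and dimension $n$ (with $i_1,\ldots,i_m\in[n]=\{1,\ldots,n\}$, $m,n\ge 2$). For $x\in\mathbb{R}^n$, $\mathcal{A}x^{m-1}\in\mathbb{R}^n$ is the vector with $(\mathcal{A}x^{m-1})_i=\sum_{i_2,\ldots,i_m=1}^n a_{i i_2\ldots i_m}x_{i_2}\cdots x_{i_m}$. A square real matrix $A$ is column competent if, for every real vector $z$, $z_i(Az)_i=0$ for all $i$ implies $Az=0$. The majorization matrix $M(\mathcal{A})$ is the $n\times n$ matrix with entries $M(\mathcal{A})_{ij}=a_{ijj\ldots j}$. Auxiliary matrix: let $N=\binom{m+n-2}{n-1}$ be the number of monomials of degree $m-1$ in $x_1,\ldots,x_n$. For $x\in\mathbb{R}^n$ let $y=(y_1,\ldots,y_N)^T$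 list these monomials, with $y_i=x_i^{m-1}$ for $i\in[n]$ and $y_{n+1},\ldots,y_N$ the remaining monomials in a fixed order (modified graded lexicographic order). Let $A\in\mathbb{R}^{n\times N}$ be the matrix with $\mathcal{A}x^{m-1}=Ay$ identically in $x$. The auxiliary matrix of $\mathcal{A}$ is $\bar{A}=\begin{pmatrix}A\\ O\end{pmatrix}\in\mathbb{R}^{N\times N}$, with $O$ the $(N-n)\times N$ zero matrix. For $q\in\mathbb{R}^n$, $\bar{q}=\begin{pmatrix} q\\ 0\end{pmatrix}\in\mathbb{R}^N$. LCP$(\bar{q},\bar{A})$: find $y,w\in\mathbb{R}^N$ with $y\ge 0$, $w=\bar{A}y+\bar{q}\ge 0$, $y^Tw=0$; $w$ is a $w$-solution if there is $y$ such that $(w,y)$ solves this problem. TCP$(q,\mathcal{A})$: find $x\in\mathbb{R}^n$ with $x\ge 0$, $\omega=\mathcal{A}x^{m-1}+q\ge 0$, $x^T\omega=0$; $\omega$ is an $\omega$-solution if there is $x$ such that $(\omega,x)$ solves this problem. *)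

theory Defs
  imports Complex_Main "Jordan_Normal_Form.Matrix" "HOL-Library.List_Lexorder"
begin

text \<open>Indices are 0-based, as in the matrix library: \<open>{..<n}\<close> plays the role of \<open>[n]\<close>.\<close>

section \<open>Tensors\<close>

definition multi_indices :: "nat \<Rightarrow> nat \<Rightarrow> nat list set" where
  "multi_indices k n = {js. length js = k \<and> set js \<subseteq> {..<n}}"

definition tensors :: "nat \<Rightarrow> nat \<Rightarrow> (nat list \<Rightarrow> real) set" where
  "tensors m n = (multi_indices m n \<rightarrow>\<^sub>E UNIV)"

text \<open>The vector \<open>\<A>x\<^bsup>m-1\<^esup>\<close>.\<close>

definition tensor_app :: "nat \<Rightarrow> nat \<Rightarrow> (nat list \<Rightarrow> real) \<Rightarrow> real vec \<Rightarrow> real vec" where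
  "tensor_app m n \<A> x =
     vec n (\<lambda>i. \<Sum>js\<in>multi_indices (m - 1) n. \<A> (i # js) * (\<Prod>j\<leftarrow>js. x $ j))"

definition majorization_mat :: "nat \<Rightarrow> nat \<Rightarrow> (nat list \<Rightarrow> real) \<Rightarrow> real mat" where
  "majorization_mat m n \<A> = mat n n (\<lambda>(i, j). \<A> (i # replicate (m - 1) j))"


section \<open>Monomials and the auxiliary matrix\<close>

text \<open>A monomial in \<open>x\<^sub>0, \<dots>, x\<^bsub>n-1\<^esub>\<close> is represented by its list of exponents.\<close>

definition exponents :: "nat \<Rightarrow> nat \<Rightarrow> nat list set" where
  "exponents d n = {\<alpha>. length \<alpha> = n \<and> sum_list \<alpha> = d}"

definition pure_powers :: "nat \<Rightarrow> nat \<Rightarrow> nat list list" where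
  "pure_powers d n = map (\<lambda>i. (replicate n 0)[i := d]) [0..<n]"

text \<open>Modified graded lexicographic order: first the pure powers \<open>x\<^sub>i\<^sup>d\<close>, then the remaining
  monomials of degree \<open>d\<close> in graded lexicographic order, that is, with exponent lists
  lexicographically decreasing.\<close>

definition monomials :: "nat \<Rightarrow> nat \<Rightarrow> nat list list" where
  "monomials d n = pure_powers d n @
     rev (sorted_list_of_set (exponents d n - set (pure_powers d n)))"

definition num_monomials :: "nat \<Rightarrow> nat \<Rightarrow> nat" where
  "num_monomials m n = (m + n - 2) choose (n - 1)"

definition monomial_vec :: "nat \<Rightarrow> nat \<Rightarrow> real vec \<Rightarrow> real vec" where
  "monomial_vec m n x =
     vec (num_monomials m n) (\<lambda>k. \<Prod>j<n. (x $ j) ^ (monomials (m - 1) n ! k ! j))"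

text \<open>The coefficient matrix \<open>A\<close> is characterised, as usual, by \<open>\<A>x\<^bsup>m-1\<^esup> = A y\<close> for all \<open>x\<close>.
  Its existence is shown in \<open>auxiliary_matrix_exists\<close> below.\<close>

definition is_auxiliary_matrix :: "nat \<Rightarrow> nat \<Rightarrow> (nat list \<Rightarrow> real) \<Rightarrow> real mat \<Rightarrow> bool" where
  "is_auxiliary_matrix m n \<A> B \<longleftrightarrow>
     (\<exists>A \<in> carrier_mat n (num_monomials m n).
        (\<forall>x \<in> carrier_vec n. tensor_app m n \<A> x = A *\<^sub>v monomial_vec m n x) \<and>
        B = A @\<^sub>r 0\<^sub>m (num_monomials m n - n) (num_monomials m n))"

definition extend_vec :: "nat \<Rightarrow> nat \<Rightarrow> real vec \<Rightarrow> real vec" where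
  "extend_vec m n q = q @\<^sub>v 0\<^sub>v (num_monomials m n - n)"


section \<open>Column competence and complementarity problems\<close>

definition column_competent :: "real mat \<Rightarrow> bool" where
  "column_competent A \<longleftrightarrow> square_mat A \<and>
     (\<forall>z \<in> carrier_vec (dim_row A).
        (\<forall>i < dim_row A. z $ i * (A *\<^sub>v z) $ i = 0) \<longrightarrow> A *\<^sub>v z = 0\<^sub>v (dim_row A))"

definition lcp_solution :: "real vec \<Rightarrow> real mat \<Rightarrow> real vec \<Rightarrow> real vec \<Rightarrow> bool" where
  "lcp_solution q A w y \<longleftrightarrow>
     y \<in> carrier_vec (dim_vec q) \<and> 0\<^sub>v (dim_vec q) \<le> y \<and>
     w = A *\<^sub>v y + q \<and> 0\<^sub>v (dim_vec q) \<le> w \<and> y \<bullet> w = 0"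

definition lcp_w_solutions :: "real vec \<Rightarrow> real mat \<Rightarrow> real vec set" where
  "lcp_w_solutions q A = {w. \<exists>y. lcp_solution q A w y}"

definition tcp_solution ::
  "nat \<Rightarrow> nat \<Rightarrow> real vec \<Rightarrow> (nat list \<Rightarrow> real) \<Rightarrow> real vec \<Rightarrow> real vec \<Rightarrow> bool" where
  "tcp_solution m n q \<A> \<omega> x \<longleftrightarrow>
     x \<in> carrier_vec n \<and> 0\<^sub>v n \<le> x \<and>
     \<omega> = tensor_app m n \<A> x + q \<and> 0\<^sub>v n \<le> \<omega> \<and> x \<bullet> \<omega> = 0"

definition tcp_omega_solutions ::
  "nat \<Rightarrow> nat \<Rightarrow> real vec \<Rightarrow> (nat list \<Rightarrow> real) \<Rightarrow> real vec set" where
  "tcp_omega_solutions m n q \<A> = {\<omega>. \<exists>x. tcp_solution m n q \<A> \<omega> x}"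


section \<open>Well-definedness of the auxiliary matrix\<close>

lemma card_exponents: "card (exponents d n) = (d + n - 1) choose d" if "n \<ge> 1"
  using card_length_sum_list[of n d] by (simp add: exponents_def)

lemma finite_exponents: "finite (exponents d n)"
proof (rule finite_subset)
  show "exponents d n \<subseteq> {xs. set xs \<subseteq> {..d} \<and> length xs = n}"
    by (auto simp: exponents_def dest: member_le_sum_list)
qed (simp add: finite_lists_length_eq)

lemma pure_powers_sub: "set (pure_powers d n) \<subseteq> exponents d n"
  by (auto simp: pure_powers_def exponents_def sum_list_update)

lemma distinct_pure_powers: "distinct (pure_powers d n)" if "d \<ge> 1"
proof -
  have "inj_on (\<lambda>i. (replicate n 0)[i := d]) {0..<n}"
  proof (rule inj_onI)
    fix i j assume "i \<in> {0..<n}" "j \<in> {0..<n}"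
      "(replicate n 0)[i := d] = (replicate n 0)[j := d]"
    then have "(replicate n 0)[i := d] ! i = (replicate n 0)[j := d] ! i" by simp
    with \<open>i \<in> _\<close> \<open>j \<in> _\<close> that show "i = j" by (auto simp: nth_list_update split: if_splits)
  qed
  then show ?thesis by (simp add: pure_powers_def distinct_map)
qed

lemma set_monomials: "set (monomials d n) = exponents d n"
  using pure_powers_sub[of d n] finite_exponents[of d n] by (auto simp: monomials_def)

lemma distinct_monomials: "distinct (monomials d n)" if "d \<ge> 1"
  using distinct_pure_powers[OF that, of n] finite_exponents[of d n] by (auto simp: monomials_def)

lemma length_monomials: "length (monomials (m - 1) n) = num_monomials m n"
  if "m \<ge> 2" "n \<ge> 2"
proof -
  have "length (monomials (m - 1) n) = card (exponents (m - 1) n)"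
    using distinct_card[OF distinct_monomials[of "m - 1" n]] that by (simp add: set_monomials)
  also have "\<dots> = (m + n - 2) choose (m - 1)"
    using card_exponents[of n "m - 1"] that by (simp add: numeral_2_eq_2)
  also have "\<dots> = num_monomials m n"
    using binomial_symmetric[of "m - 1" "m + n - 2"] that by (simp add: num_monomials_def)
  finally show ?thesis .
qed

lemma finite_multi_indices: "finite (multi_indices k n)"
  using finite_lists_length_eq[of "{..<n}" k] by (simp add: multi_indices_def conj_commute)

lemma prod_list_count:
  "set js \<subseteq> {..<n} \<Longrightarrow> (\<Prod>j\<leftarrow>js. x $ j :: real) = (\<Prod>j<n. (x $ j) ^ count_list js j)"
proof (induction js)
  case (Cons i js)
  have "(\<Prod>j<n. (x $ j) ^ count_list (i # js) j)
      = (\<Prod>j<n. (if j = i then x $ j else 1) * (x $ j) ^ count_list js j)"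
    by (rule prod.cong) auto
  also have "\<dots> = x $ i * (\<Prod>j<n. (x $ j) ^ count_list js j)"
    using Cons.prems by (simp add: prod.distrib)
  finally show ?case using Cons by simp
qed simp

lemma sum_count_list:
  fixes js :: "nat list"
  shows "set js \<subseteq> {..<n} \<Longrightarrow> (\<Sum>j<n. count_list js j) = length js"
proof (induction js)
  case (Cons i js)
  have "(\<Sum>j<n. count_list (i # js) j) = (\<Sum>j<n. (if j = i then 1 else 0) + count_list js j)"
    by (rule sum.cong) auto
  also have "\<dots> = Suc (\<Sum>j<n. count_list js j)"
    using Cons.prems by (simp add: sum.distrib)
  finally show ?case using Cons by simp
qed simp

lemma auxiliary_matrix_exists: "\<exists>B. is_auxiliary_matrix m n \<A> B" if mn: "m \<ge> 2" "n \<ge> 2"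
proof -
  let ?N = "num_monomials m n" and ?I = "multi_indices (m - 1) n"
  let ?mons = "monomials (m - 1) n"
  define cnt where "cnt js = map (count_list js) [0..<n]" for js :: "nat list"
  define A where "A = mat n ?N (\<lambda>(i, k). \<Sum>js\<in>{js \<in> ?I. cnt js = ?mons ! k}. \<A> (i # js))"
  have len: "length ?mons = ?N" using length_monomials[OF mn] .
  have bij: "bij_betw ((!) ?mons) {..<?N} (exponents (m - 1) n)"
    using bij_betw_nth[OF distinct_monomials[of "m - 1" n] refl refl] mn len
    by (simp add: set_monomials)
  have cnt_in: "cnt js \<in> exponents (m - 1) n" if "js \<in> ?I" for js
    using that sum_count_list[of js n]
    by (auto simp: cnt_def exponents_def multi_indices_def sum_list_sum_nth atLeast0LessThan)
  have "tensor_app m n \<A> x = A *\<^sub>v monomial_vec m n x" if x: "x \<in> carrier_vec n" for x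
  proof (rule eq_vecI)
    fix i assume "i < dim_vec (A *\<^sub>v monomial_vec m n x)"
    then have i: "i < n" by (simp add: A_def)
    let ?p = "\<lambda>\<alpha>. \<Prod>j<n. (x $ j) ^ (\<alpha> ! j)"
    have "tensor_app m n \<A> x $ i = (\<Sum>js\<in>?I. \<A> (i # js) * ?p (cnt js))"
      using i by (auto simp: tensor_app_def multi_indices_def prod_list_count cnt_def intro!: sum.cong)
    also have "\<dots> = (\<Sum>\<alpha>\<in>exponents (m - 1) n. \<Sum>js\<in>{js \<in> ?I. cnt js = \<alpha>}. \<A> (i # js) * ?p (cnt js))"
      by (rule sum.group[OF finite_multi_indices finite_exponents, symmetric]) (use cnt_in in blast)
    also have "\<dots> = (\<Sum>k<?N. \<Sum>js\<in>{js \<in> ?I. cnt js = ?mons ! k}. \<A> (i # js) * ?p (cnt js))"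
      by (rule sum.reindex_bij_betw[OF bij, symmetric])
    also have "\<dots> = (\<Sum>k<?N. A $$ (i, k) * monomial_vec m n x $ k)"
      using i by (auto simp: A_def monomial_vec_def sum_distrib_right intro!: sum.cong)
    also have "\<dots> = (A *\<^sub>v monomial_vec m n x) $ i"
      using i by (simp add: A_def monomial_vec_def scalar_prod_def atLeast0LessThan)
    finally show "tensor_app m n \<A> x $ i = (A *\<^sub>v monomial_vec m n x) $ i" .
  qed (simp add: tensor_app_def A_def)
  moreover have "A \<in> carrier_mat n ?N" by (simp add: A_def)
  ultimately show ?thesis unfolding is_auxiliary_matrix_def by blast
qed

end

theory Submission
  imports Defs
begin

text \<open>Both problems reduce to the LCP of the majorization matrix \<open>M\<close>: the coordinates of the
  auxiliary LCP beyond the first \<open>n\<close> carry no information, and the bijection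
  \<open>x\<^sub>i \<mapsto> x\<^sub>i\<^bsup>m-1\<^esup>\<close> of the nonnegative orthant turns the TCP into the LCP of \<open>M\<close>.
  For a column competent matrix, a \<open>w\<close>-solution is determined by the support of a matching \<open>y\<close>,
  so there are finitely many. Conversely, if \<open>z\<^sub>i (M z)\<^sub>i = 0\<close> for all \<open>i\<close> but \<open>M z \<noteq> 0\<close>, then
  \<open>y = \<bar>z\<bar> + t z\<close>, \<open>w = \<bar>M z\<bar> + t M z\<close> with \<open>t \<in> [0, 1]\<close> solve one and the same LCP.\<close>

section \<open>Complementarity problems coordinate by coordinate\<close>

lemma nonneg_scalar_prod_eq_0_iff:
  fixes x y :: "real vec"
  assumes "x \<in> carrier_vec n" "y \<in> carrier_vec n" "0\<^sub>v n \<le> x" "0\<^sub>v n \<le> y"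
  shows "x \<bullet> y = 0 \<longleftrightarrow> (\<forall>i<n. x $ i * y $ i = 0)"
proof -
  have "x \<bullet> y = 0 \<longleftrightarrow> (\<forall>i\<in>{0..<n}. x $ i * y $ i = 0)"
    unfolding scalar_prod_def carrier_vecD[OF assms(2)]
    by (rule sum_nonneg_eq_0_iff) (use assms in \<open>auto simp: less_eq_vec_def\<close>)
  then show ?thesis by auto
qed

lemma lcp_solution_iff:
  assumes "M \<in> carrier_mat n n" "q \<in> carrier_vec n"
  shows "lcp_solution q M w y \<longleftrightarrow>
    y \<in> carrier_vec n \<and> w = M *\<^sub>v y + q \<and>
    (\<forall>i<n. 0 \<le> y $ i \<and> 0 \<le> w $ i \<and> y $ i * w $ i = 0)"
proof (cases "y \<in> carrier_vec n \<and> w = M *\<^sub>v y + q")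
  case True
  then have w: "w \<in> carrier_vec n" using assms by simp
  have "0\<^sub>v n \<le> v \<longleftrightarrow> (\<forall>i<n. 0 \<le> v $ i)" if "v \<in> carrier_vec n" for v :: "real vec"
    using that by (auto simp: less_eq_vec_def)
  then show ?thesis
    using True w nonneg_scalar_prod_eq_0_iff[of y n w] assms by (auto simp: lcp_solution_def)
qed (use assms in \<open>auto simp: lcp_solution_def\<close>)

lemma tcp_solution_iff:
  assumes "q \<in> carrier_vec n"
  shows "tcp_solution m n q \<A> \<omega> x \<longleftrightarrow>
    x \<in> carrier_vec n \<and> \<omega> = tensor_app m n \<A> x + q \<and>
    (\<forall>i<n. 0 \<le> x $ i \<and> 0 \<le> \<omega> $ i \<and> x $ i * \<omega> $ i = 0)"
proof (cases "x \<in> carrier_vec n \<and> \<omega> = tensor_app m n \<A> x + q")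
  case True
  then have w: "\<omega> \<in> carrier_vec n" using assms by (simp add: tensor_app_def)
  have "0\<^sub>v n \<le> v \<longleftrightarrow> (\<forall>i<n. 0 \<le> v $ i)" if "v \<in> carrier_vec n" for v :: "real vec"
    using that by (auto simp: less_eq_vec_def)
  then show ?thesis
    using True w nonneg_scalar_prod_eq_0_iff[of x n \<omega>] assms by (auto simp: tcp_solution_def)
qed (use assms in \<open>auto simp: tcp_solution_def\<close>)

section \<open>Column competence and finiteness of the \<open>w\<close>-solutions\<close>

text \<open>Supports are subsets of \<open>{..<n}\<close>, so it suffices that \<open>w\<close> can
  be recovered from the support of its \<open>y\<close>. For two solutions with equal supports, the
  difference \<open>z\<close> of the \<open>y\<close>-parts satisfies the premise of column
  competence, and \<open>M *\<^sub>v z\<close> is the difference of the \<open>w\<close>-parts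
  because \<open>q\<close> cancels.\<close>

lemma finite_lcp_w_solutions_if_column_competent:
  assumes M: "M \<in> carrier_mat n n" and q: "q \<in> carrier_vec n" and cc: "column_competent M"
  shows "finite (lcp_w_solutions q M)"
proof -
  \<comment> \<open>A \<open>w\<close>-solution may have many partners \<open>y\<close>; fixing one
    makes the support a function of \<open>w\<close>.\<close>
  define Y where "Y w = (SOME y. lcp_solution q M w y)" for w
  define S where "S w = {i. i < n \<and> Y w $ i \<noteq> 0}" for w
  have Y: "lcp_solution q M w (Y w)" if "w \<in> lcp_w_solutions q M" for w
    using that unfolding Y_def lcp_w_solutions_def by (auto intro: someI)
  have "inj_on S (lcp_w_solutions q M)"
  proof (rule inj_onI)
    fix v w assume vw: "v \<in> lcp_w_solutions q M" "w \<in> lcp_w_solutions q M" and eq: "S v = S w"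
    note sol = Y[OF vw(1), unfolded lcp_solution_iff[OF M q]]
      Y[OF vw(2), unfolded lcp_solution_iff[OF M q]]
    define z where "z = Y v - Y w"
    have z: "z \<in> carrier_vec n" using sol by (simp add: z_def)
    have Mz: "M *\<^sub>v z = M *\<^sub>v Y v - M *\<^sub>v Y w"
      using sol M by (simp add: z_def mult_minus_distrib_mat_vec)
    have Mzi: "(M *\<^sub>v z) $ i = v $ i - w $ i" if "i < n" for i
    proof -
      have "v $ i = (M *\<^sub>v Y v) $ i + q $ i"
        using arg_cong[of v _ "\<lambda>u. u $ i"] sol that q M
        by (metis carrier_vecD index_add_vec(1))
      moreover have "w $ i = (M *\<^sub>v Y w) $ i + q $ i"
        using arg_cong[of w _ "\<lambda>u. u $ i"] sol that q M
        by (metis carrier_vecD index_add_vec(1))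
      ultimately show ?thesis unfolding Mz using that M by simp
    qed
    \<comment> \<open>On the common support complementarity forces \<open>v $ i = w $ i = 0\<close>;
      off it both \<open>y\<close>-parts vanish, hence so does \<open>z $ i\<close>.\<close>
    have "z $ i * (M *\<^sub>v z) $ i = 0" if i: "i < n" for i
    proof (cases "i \<in> S v")
      case True
      then have "Y v $ i \<noteq> 0" "Y w $ i \<noteq> 0" using eq by (auto simp: S_def)
      then have "v $ i = 0" "w $ i = 0" using sol i by force+
      then show ?thesis using Mzi[OF i] by simp
    next
      case False
      then have "Y v $ i = 0" "Y w $ i = 0" using eq i by (auto simp: S_def)
      then have "z $ i = 0" using i sol by (auto simp: z_def)
      then show ?thesis by simp
    qed
    then have "M *\<^sub>v z = 0\<^sub>v n" using cc M z by (auto simp: column_competent_def)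
    then have "v $ i = w $ i" if "i < n" for i using Mzi[OF that] that by simp
    moreover have "dim_vec v = n" "dim_vec w = n"
      using sol q by (metis carrier_vecD index_add_vec(2))+
    ultimately show "v = w" by (intro eq_vecI) auto
  qed
  moreover have "finite (S ` lcp_w_solutions q M)"
    by (rule finite_subset[of _ "Pow {..<n}"]) (auto simp: S_def)
  ultimately show ?thesis by (rule finite_imageD[rotated])
qed

text \<open>By contradiction: a vector \<open>z\<close> violating column competence yields a whole
  segment of \<open>w\<close>-solutions for one suitable \<open>q\<close>.\<close>

lemma column_competent_if_finite_lcp_w_solutions:
  assumes M: "M \<in> carrier_mat n n"
    and fin: "\<And>q. q \<in> carrier_vec n \<Longrightarrow> finite (lcp_w_solutions q M)"
  shows "column_competent M"
proof -
  have "M *\<^sub>v z = 0\<^sub>v n"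
    if z: "z \<in> carrier_vec n" and zM: "\<forall>i<n. z $ i * (M *\<^sub>v z) $ i = 0" for z
  proof (rule ccontr)
    assume nz: "M *\<^sub>v z \<noteq> 0\<^sub>v n"
    define v where "v = M *\<^sub>v z"
    have v: "v \<in> carrier_vec n" using M z by (simp add: v_def)
    obtain k where k: "k < n" "v $ k \<noteq> 0"
      using nz v unfolding v_def[symmetric] by (metis carrier_vecD eq_vecI index_zero_vec)
    \<comment> \<open>The absolute values make both vectors nonnegative at \<open>t = 0\<close>, and
      \<open>q\<close> is chosen so that they solve the problem there. Raising \<open>t\<close> adds
      \<open>t \<cdot>\<^sub>v z\<close> to \<open>y\<close> and its image under \<open>M\<close> to
      \<open>w\<close>, so the same \<open>q\<close> serves every \<open>t\<close>.\<close>
    define y w where "y t = map_vec abs z + t \<cdot>\<^sub>v z" and "w t = map_vec abs v + t \<cdot>\<^sub>v v" for t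
    define q where "q = map_vec abs v - M *\<^sub>v map_vec abs z"
    have q: "q \<in> carrier_vec n"
      using M v z by (auto simp: q_def)
    have "lcp_solution q M (w t) (y t)" if t: "t \<in> {0..1}" for t
    proof -
      have nn: "0 \<le> \<bar>a\<bar> + t * a" for a :: real
      proof -
        have "\<bar>t * a\<bar> \<le> \<bar>a\<bar>" using t by (simp add: abs_mult mult_left_le_one_le)
        then show ?thesis by linarith
      qed
      have "M *\<^sub>v y t = M *\<^sub>v map_vec abs z + t \<cdot>\<^sub>v v"
        using M z by (simp add: y_def v_def mult_add_distrib_mat_vec[of M n n] mult_mat_vec[of M n n])
      then have "w t = M *\<^sub>v y t + q"
        using M z v by (intro eq_vecI) (auto simp: w_def q_def)
      \<comment> \<open>At each index \<open>z $ i\<close> or \<open>v $ i\<close> is zero, and then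
        so is the factor built from it.\<close>
      moreover have "y t $ i * w t $ i = 0" if "i < n" for i
        using zM that z v by (auto simp: y_def w_def v_def[symmetric])
      moreover have "0 \<le> y t $ i" "0 \<le> w t $ i" if "i < n" for i
        using that z v nn by (auto simp: y_def w_def)
      ultimately show ?thesis
        unfolding lcp_solution_iff[OF M q] using z by (simp add: y_def)
    qed
    then have "w ` {0..1} \<subseteq> lcp_w_solutions q M" unfolding lcp_w_solutions_def by blast
    \<comment> \<open>The coordinate \<open>k\<close>, where \<open>v\<close> is nonzero, tells the
      parameters apart.\<close>
    moreover have "inj_on w {0..1}"
    proof (rule inj_onI)
      fix s t assume "w s = w t"
      then have "w s $ k = w t $ k" by simp
      then show "s = t" using k v by (simp add: w_def)
    qed
    then have "infinite (w ` {0..1})" by (simp add: finite_image_iff infinite_Icc)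
    ultimately show False using fin[OF q] finite_subset by blast
  qed
  then show ?thesis using M by (auto simp: column_competent_def)
qed

lemma column_competent_iff_finite_lcp_w_solutions:
  assumes "M \<in> carrier_mat n n"
  shows "column_competent M \<longleftrightarrow> (\<forall>q\<in>carrier_vec n. finite (lcp_w_solutions q M))"
  using finite_lcp_w_solutions_if_column_competent[OF assms]
    column_competent_if_finite_lcp_w_solutions[OF assms] by blast

section \<open>Padding a matrix with zero blocks\<close>

text \<open>This is the block form assumed of the auxiliary matrix, with an arbitrary number
  \<open>r\<close> of extra coordinates in place of \<open>num_monomials m n - n\<close>.\<close>

definition pad_mat :: "nat \<Rightarrow> real mat \<Rightarrow> real mat" where
  "pad_mat r M = four_block_mat M (0\<^sub>m (dim_row M) r) (0\<^sub>m r (dim_col M)) (0\<^sub>m r r)"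

lemma pad_mat_carrier: "M \<in> carrier_mat n n \<Longrightarrow> pad_mat r M \<in> carrier_mat (n + r) (n + r)"
  by (auto simp: pad_mat_def)

lemma pad_mat_mult_vec:
  assumes M: "M \<in> carrier_mat n n" and y: "y \<in> carrier_vec (n + r)"
  shows "pad_mat r M *\<^sub>v y = (M *\<^sub>v vec_first y n) @\<^sub>v 0\<^sub>v r"
proof -
  have "y = vec_first y n @\<^sub>v vec_last y r" using y by simp
  then have "pad_mat r M *\<^sub>v y
      = four_block_mat M (0\<^sub>m n r) (0\<^sub>m r n) (0\<^sub>m r r) *\<^sub>v (vec_first y n @\<^sub>v vec_last y r)"
    using M by (simp add: pad_mat_def)
  also have "\<dots> = (M *\<^sub>v vec_first y n + 0\<^sub>m n r *\<^sub>v vec_last y r)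
      @\<^sub>v (0\<^sub>m r n *\<^sub>v vec_first y n + 0\<^sub>m r r *\<^sub>v vec_last y r)"
    by (rule four_block_mat_mult_vec[OF M]) auto
  also have "\<dots> = (M *\<^sub>v vec_first y n) @\<^sub>v 0\<^sub>v r"
    using M by (intro eq_vecI) auto
  finally show ?thesis .
qed

lemma vec_first_append:
  assumes "v \<in> carrier_vec n"
  shows "vec_first (v @\<^sub>v w) n = v"
  using assms by (intro eq_vecI) (auto simp: vec_first_def)

lemma zero_vec_append: "0\<^sub>v n @\<^sub>v 0\<^sub>v r = (0\<^sub>v (n + r) :: real vec)"
  by (intro eq_vecI) auto

text \<open>The product with a padded matrix depends only on the first \<open>n\<close> coordinates
  and is zero beyond them. Test vectors therefore pass in one direction by appending zeros, in the
  other by truncation.\<close>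

lemma column_competent_pad_mat:
  assumes M: "M \<in> carrier_mat n n"
  shows "column_competent (pad_mat r M) \<longleftrightarrow> column_competent M"
proof
  assume L: "column_competent (pad_mat r M)"
  have "M *\<^sub>v z = 0\<^sub>v n"
    if z: "z \<in> carrier_vec n" and zM: "\<forall>i<n. z $ i * (M *\<^sub>v z) $ i = 0" for z
  proof -
    have c: "z @\<^sub>v 0\<^sub>v r \<in> carrier_vec (n + r)" using z by simp
    have e: "pad_mat r M *\<^sub>v (z @\<^sub>v 0\<^sub>v r) = (M *\<^sub>v z) @\<^sub>v 0\<^sub>v r"
      using pad_mat_mult_vec[OF M c] unfolding vec_first_append[OF z] .
    have "(z @\<^sub>v 0\<^sub>v r) $ i * (pad_mat r M *\<^sub>v (z @\<^sub>v 0\<^sub>v r)) $ i = 0" if "i < n + r" for i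
      unfolding e using that zM z M by (cases "i < n") (simp_all del: index_mult_mat_vec)
    then have "pad_mat r M *\<^sub>v (z @\<^sub>v 0\<^sub>v r) = 0\<^sub>v (n + r)"
      using L c carrier_matD[OF pad_mat_carrier[OF M, of r]] unfolding column_competent_def
      by metis
    then have "(M *\<^sub>v z) @\<^sub>v 0\<^sub>v r = 0\<^sub>v n @\<^sub>v 0\<^sub>v r" unfolding e zero_vec_append .
    then show ?thesis using append_vec_eq[OF mult_mat_vec_carrier[OF M z] zero_carrier_vec] by blast
  qed
  then show "column_competent M" using M by (auto simp: column_competent_def)
next
  assume R: "column_competent M"
  have "pad_mat r M *\<^sub>v z = 0\<^sub>v (n + r)"
    if z: "z \<in> carrier_vec (n + r)"
      and zM: "\<forall>i<n+r. z $ i * (pad_mat r M *\<^sub>v z) $ i = 0" for z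
  proof -
    have "vec_first z n $ i * (M *\<^sub>v vec_first z n) $ i = 0" if "i < n" for i
      using zM[rule_format, of i] that M z
      by (simp add: pad_mat_mult_vec[OF M z] vec_first_def)
    then have "M *\<^sub>v vec_first z n = 0\<^sub>v n"
      using R M by (auto simp: column_competent_def)
    then show ?thesis by (simp add: pad_mat_mult_vec[OF M z] zero_vec_append)
  qed
  then show "column_competent (pad_mat r M)"
    using pad_mat_carrier[OF M, of r] by (auto simp: column_competent_def)
qed

text \<open>Beyond the first \<open>n\<close> coordinates \<open>w\<close> is zero, so
  complementarity holds there for any nonnegative \<open>y\<close>. Truncating \<open>y\<close> thus
  loses nothing, and appending zeros to a solution gives a solution.\<close>

lemma lcp_w_solutions_pad_mat:
  assumes M: "M \<in> carrier_mat n n" and q: "q \<in> carrier_vec n"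
  shows "lcp_w_solutions (q @\<^sub>v 0\<^sub>v r) (pad_mat r M) = (\<lambda>w. w @\<^sub>v 0\<^sub>v r) ` lcp_w_solutions q M"
proof -
  have qr: "q @\<^sub>v 0\<^sub>v r \<in> carrier_vec (n + r)" using q by simp
  note iff = lcp_solution_iff[OF pad_mat_carrier[OF M] qr] lcp_solution_iff[OF M q]
  have eq: "pad_mat r M *\<^sub>v y + (q @\<^sub>v 0\<^sub>v r) = (M *\<^sub>v vec_first y n + q) @\<^sub>v 0\<^sub>v r"
    if "y \<in> carrier_vec (n + r)" for y
    using M q unfolding pad_mat_mult_vec[OF M that] by (intro eq_vecI) auto
  show ?thesis
  proof (intro equalityI subsetI)
    fix w assume "w \<in> lcp_w_solutions (q @\<^sub>v 0\<^sub>v r) (pad_mat r M)"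
    then obtain y where y: "lcp_solution (q @\<^sub>v 0\<^sub>v r) (pad_mat r M) w y"
      by (auto simp: lcp_w_solutions_def)
    then have yc: "y \<in> carrier_vec (n + r)" unfolding iff by simp
    define u where "u = M *\<^sub>v vec_first y n + q"
    have w: "w = u @\<^sub>v 0\<^sub>v r" using y eq[OF yc] unfolding iff u_def by simp
    have "0 \<le> vec_first y n $ i \<and> 0 \<le> u $ i \<and> vec_first y n $ i * u $ i = 0" if "i < n" for i
    proof -
      have "w $ i = u $ i" using that M q by (simp add: w u_def)
      moreover have "vec_first y n $ i = y $ i" using that by (simp add: vec_first_def)
      moreover have "0 \<le> y $ i \<and> 0 \<le> w $ i \<and> y $ i * w $ i = 0"
        using y[unfolded iff] trans_less_add1[OF that] by blast
      ultimately show ?thesis by simp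
    qed
    then have "lcp_solution q M u (vec_first y n)" unfolding iff by (simp add: u_def)
    then show "w \<in> (\<lambda>w. w @\<^sub>v 0\<^sub>v r) ` lcp_w_solutions q M"
      unfolding w lcp_w_solutions_def by blast
  next
    fix w assume "w \<in> (\<lambda>w. w @\<^sub>v 0\<^sub>v r) ` lcp_w_solutions q M"
    then obtain u y where w: "w = u @\<^sub>v 0\<^sub>v r" and u: "lcp_solution q M u y"
      by (auto simp: lcp_w_solutions_def)
    have yc: "y \<in> carrier_vec n" and ue: "u = M *\<^sub>v y + q" using u unfolding iff by simp_all
    have uc: "u \<in> carrier_vec n" unfolding ue using M q yc by auto
    have c: "y @\<^sub>v 0\<^sub>v r \<in> carrier_vec (n + r)" using yc by simp
    have "w = pad_mat r M *\<^sub>v (y @\<^sub>v 0\<^sub>v r) + (q @\<^sub>v 0\<^sub>v r)"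
      unfolding eq[OF c] w ue vec_first_append[OF yc] ..
    moreover have "0 \<le> (y @\<^sub>v 0\<^sub>v r) $ i \<and> 0 \<le> w $ i \<and> (y @\<^sub>v 0\<^sub>v r) $ i * w $ i = 0"
      if "i < n + r" for i
    proof -
      have "\<forall>i<n. 0 \<le> y $ i \<and> 0 \<le> u $ i \<and> y $ i * u $ i = 0" using u unfolding iff by blast
      then show ?thesis
        using that carrier_vecD[OF yc] carrier_vecD[OF uc] by (cases "i < n") (simp_all add: w)
    qed
    ultimately have "lcp_solution (q @\<^sub>v 0\<^sub>v r) (pad_mat r M) w (y @\<^sub>v 0\<^sub>v r)"
      unfolding iff using c by simp
    then show "w \<in> lcp_w_solutions (q @\<^sub>v 0\<^sub>v r) (pad_mat r M)"
      by (auto simp: lcp_w_solutions_def)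
  qed
qed

lemma finite_lcp_w_solutions_pad_mat:
  assumes "M \<in> carrier_mat n n" "q \<in> carrier_vec n"
  shows "finite (lcp_w_solutions (q @\<^sub>v 0\<^sub>v r) (pad_mat r M)) \<longleftrightarrow> finite (lcp_w_solutions q M)"
proof -
  have "lcp_w_solutions q M \<subseteq> carrier_vec n"
    using assms lcp_solution_iff[OF assms] by (auto simp: lcp_w_solutions_def)
  then have "inj_on (\<lambda>w. w @\<^sub>v 0\<^sub>v r) (lcp_w_solutions q M)"
    by (intro inj_onI) (metis append_vec_eq subsetD)
  then show ?thesis by (simp add: lcp_w_solutions_pad_mat[OF assms] finite_image_iff)
qed

section \<open>From the tensor to the majorization matrix\<close>

text \<open>The pure powers alone fill \<open>n\<close> places of the monomial list. The bound
  ensures that the truncated subtraction \<open>num_monomials m n - n\<close> is a genuine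
  one.\<close>

lemma num_monomials_ge:
  assumes "m \<ge> 2" "n \<ge> 2"
  shows "n \<le> num_monomials m n"
  unfolding length_monomials[OF assms, symmetric] by (simp add: monomials_def pure_powers_def)

lemma monomial_vec_pure_power:
  assumes "m \<ge> 2" "n \<ge> 2" "i < n"
  shows "monomial_vec m n x $ i = (x $ i) ^ (m - 1)"
proof -
  have mon: "monomials (m - 1) n ! i = (replicate n 0)[i := m - 1]"
    using assms(3) by (simp add: monomials_def pure_powers_def nth_append)
  have "monomial_vec m n x $ i = (\<Prod>j<n. (x $ j) ^ ((replicate n 0)[i := m - 1] ! j))"
    using num_monomials_ge[OF assms(1,2)] assms(3) mon by (simp add: monomial_vec_def)
  also have "\<dots> = (\<Prod>j<n. if j = i then (x $ j) ^ (m - 1) else 1)"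
    using assms(3) by (intro prod.cong) (auto simp: nth_list_update)
  also have "\<dots> = (x $ i) ^ (m - 1)" using assms(3) by simp
  finally show ?thesis .
qed

text \<open>In the block form only the pure powers, which come first in the monomial order, have
  nonzero coefficients. The proof computes the product of the auxiliary matrix with the monomial
  vector in two ways and compares the first \<open>n\<close> coordinates.\<close>

lemma tensor_app_eq_mat_mult_powers:
  assumes mn: "m \<ge> 2" "n \<ge> 2" and M: "M \<in> carrier_mat n n" and x: "x \<in> carrier_vec n"
    and aux: "is_auxiliary_matrix m n \<A> (pad_mat (num_monomials m n - n) M)"
  shows "tensor_app m n \<A> x = M *\<^sub>v vec n (\<lambda>i. (x $ i) ^ (m - 1))"
proof -
  let ?N = "num_monomials m n" and ?v = "monomial_vec m n x"
  let ?r = "?N - n"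
  obtain A where A: "A \<in> carrier_mat n ?N" and tA: "tensor_app m n \<A> x = A *\<^sub>v ?v"
    and B: "pad_mat ?r M = A @\<^sub>r 0\<^sub>m ?r ?N"
    using aux x unfolding is_auxiliary_matrix_def by blast
  have N: "n + ?r = ?N" using num_monomials_ge[OF mn] by simp
  have v: "?v \<in> carrier_vec ?N" by (simp add: monomial_vec_def)
  have first: "vec_first ?v n = vec n (\<lambda>i. (x $ i) ^ (m - 1))"
    by (intro eq_vecI) (auto simp: vec_first_def monomial_vec_pure_power[OF mn])
  have "A *\<^sub>v ?v @\<^sub>v 0\<^sub>m ?r ?N *\<^sub>v ?v = pad_mat ?r M *\<^sub>v ?v"
    unfolding B using mat_mult_append[OF A zero_carrier_mat v, of ?r] by simp
  also have "\<dots> = (M *\<^sub>v vec_first ?v n) @\<^sub>v 0\<^sub>v ?r"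
    using pad_mat_mult_vec[OF M] v N by simp
  finally have "A *\<^sub>v ?v = M *\<^sub>v vec_first ?v n"
    using append_vec_eq[OF mult_mat_vec_carrier[OF A v] mult_mat_vec_carrier[OF M vec_first_carrier]]
    by blast
  then show ?thesis by (simp add: tA first)
qed

text \<open>Since \<open>m - 1\<close> is positive, the coordinatewise power is a bijection of the
  nonnegative orthant that preserves zeros, hence complementarity. Only the unknown is substituted;
  \<open>w\<close> itself stays the same.\<close>

lemma tcp_omega_solutions_eq_lcp_w_solutions:
  assumes m: "m \<ge> 2" and M: "M \<in> carrier_mat n n" and q: "q \<in> carrier_vec n"
    and app: "\<And>x. x \<in> carrier_vec n \<Longrightarrow>
      tensor_app m n \<A> x = M *\<^sub>v vec n (\<lambda>i. (x $ i) ^ (m - 1))"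
  shows "tcp_omega_solutions m n q \<A> = lcp_w_solutions q M"
proof (intro equalityI subsetI)
  fix w assume "w \<in> tcp_omega_solutions m n q \<A>"
  then obtain x where "tcp_solution m n q \<A> w x" by (auto simp: tcp_omega_solutions_def)
  then have "lcp_solution q M w (vec n (\<lambda>i. (x $ i) ^ (m - 1)))"
    using app m unfolding lcp_solution_iff[OF M q] tcp_solution_iff[OF q] by auto
  then show "w \<in> lcp_w_solutions q M" by (auto simp: lcp_w_solutions_def)
next
  fix w assume "w \<in> lcp_w_solutions q M"
  then obtain y where "lcp_solution q M w y" by (auto simp: lcp_w_solutions_def)
  then have y: "y \<in> carrier_vec n" "w = M *\<^sub>v y + q"
    "\<forall>i<n. 0 \<le> y $ i \<and> 0 \<le> w $ i \<and> y $ i * w $ i = 0"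
    unfolding lcp_solution_iff[OF M q] by auto
  \<comment> \<open>The root inverts the power here because \<open>y\<close> is nonnegative and the
    index \<open>m - 1\<close> is positive.\<close>
  define x where "x = vec n (\<lambda>i. root (m - 1) (y $ i))"
  have x: "x \<in> carrier_vec n" by (simp add: x_def)
  have "vec n (\<lambda>i. (x $ i) ^ (m - 1)) = y"
    using y m by (intro eq_vecI) (auto simp: x_def real_root_pow_pos2)
  then have "w = tensor_app m n \<A> x + q" using app[OF x] y by simp
  moreover have "0 \<le> x $ i \<and> 0 \<le> w $ i \<and> x $ i * w $ i = 0" if "i < n" for i
    using y(3) that m by (auto simp: x_def)
  ultimately have "tcp_solution m n q \<A> w x" unfolding tcp_solution_iff[OF q] using x by blast
  then show "w \<in> tcp_omega_solutions m n q \<A>" by (auto simp: tcp_omega_solutions_def)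
qed

theorem theorem3p13:
  fixes m n :: nat and \<A> :: "nat list \<Rightarrow> real" and B :: "real mat"
  assumes "m \<ge> 2" and "n \<ge> 2" and "even m"
    and "\<A> \<in> tensors m n"
    and "is_auxiliary_matrix m n \<A> B"
    and "B = four_block_mat
               (majorization_mat m n \<A>)             (0\<^sub>m n (num_monomials m n - n))
               (0\<^sub>m (num_monomials m n - n) n)
               (0\<^sub>m (num_monomials m n - n) (num_monomials m n - n))"
  shows "(column_competent B \<longleftrightarrow>
            (\<forall>q \<in> carrier_vec n. finite (lcp_w_solutions (extend_vec m n q) B)))
       \<and> ((\<forall>q \<in> carrier_vec n. finite (lcp_w_solutions (extend_vec m n q) B)) \<longleftrightarrow>
            (\<forall>q \<in> carrier_vec n. finite (tcp_omega_solutions m n q \<A>)))"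
proof -
  define M where "M = majorization_mat m n \<A>"
  have M: "M \<in> carrier_mat n n" by (simp add: M_def majorization_mat_def)
  have B: "B = pad_mat (num_monomials m n - n) M"
    using assms(6) M by (simp add: pad_mat_def M_def[symmetric])
  have tcp: "tcp_omega_solutions m n q \<A> = lcp_w_solutions q M" if "q \<in> carrier_vec n" for q
    using tcp_omega_solutions_eq_lcp_w_solutions[OF assms(1) M that]
      tensor_app_eq_mat_mult_powers[OF assms(1,2) M _ assms(5)[unfolded B]] by blast
  \<comment> \<open>All three properties are rewritten to the finiteness of
    \<open>lcp_w_solutions q M\<close> for every \<open>q\<close>.\<close>
  show ?thesis
    by (simp add: B extend_vec_def column_competent_pad_mat[OF M]
        finite_lcp_w_solutions_pad_mat[OF M] column_competent_iff_finite_lcp_w_solutions[OF M] tcp)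
qed

end
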